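(* Let $V$ be a rational vector space and fix a rational scalar product on $V^*$. Let $\mathfrak{p}\subset V$ be a rational polyhedron and let $\mathfrak{f}$ be a face of $\mathfrak{p}$. Let $\mathcal{L}$ be a finite family of rational vector subspaces of $V$, stable under sum, let $\rho$ be a patchwork function on $\mathcal{L}$, and let $S^{(\mathcal{L},\rho)}=\sum_{L\in\mathcal{L}}\rho(L)S^L$. Assume that $\operatorname{lin}(\mathfrak{f})$ belongs to $\mathcal{L}$. Then $$\mu^{(\mathcal{L},\rho)}(\mathfrak{t}(\mathfrak{p},\mathfrak{f}))=\mu^{\{0\}}(\mathfrak{t}(\mathfrak{p},\mathfrak{f})),$$ where $$\mu^{(\mathcal{L},\rho)}(\mathfrak{t}(\mathfrak{p},\mathfrak{f})):=\sum_{L\in\mathcal{L}}\rho(L)\,\mu^{(L+\operatorname{lin}(\mathfrak{f}))/\operatorname{lin}(\mathfrak{f})}(\mathfrak{t}(\mathfrak{p},\mathfrak{f})).$$ In other words, the $\mathfrak{f}$-term in the local Euler-Maclaurin expansion of $S^{(\mathcal{L},\rho)}(\mathfrak{p})$ coincides with that of $S(\mathfrak{p})=S^{\{0\}}(\mathfrak{p})$.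
   Context: Rational spaces. A rational vector space is a finite dimensional real vector space $V$ with a lattice $\Lambda=\Lambda_V$ (a discrete additive subgroup generating $V$ as a vector space). A point $x\in V$ is rational if $qx\in\Lambda$ for some integer $q\neq0$. A subspace $L\subseteq V$ is rational if $L\cap\Lambda$ is a lattice in $L$; then $V/L$ is a rational space with lattice $\Lambda_{V/L}$, the image of $\Lambda$ in $V/L$ (a rational quotient space of $V$). The dual $(V/L)^*$ is identified with $L^\perp=\{\xi\in V^*:\langle\xi,x\rangle=0\ \forall x\in L\}\subset V^*$, so it inherits the scalar product by restriction. A scalar product is rational if it takes rational values on rational points. An affine subspace is rational if it is a translate of a rational subspace by a rational point. A rational space carries the Lebesgue measure for which $V/\Lambda$ has measure $1$; a rational affine subspace $A$ parallel to a rational subspace $L$ carries the Lebesgue measure $dm_A$ translated from that of $L$ (with lattice $L\cap\Lambda$). Polyhedra and cones. A (rational) polyhedron $\mathfrak{p}\subset V$ is an intersection of finitely many half-spaces bounded by rational affine hyperplanes. For $S\subset V$, $\langle S\rangle$ is the affine span of $S$ and $\operatorname{lin}(S)$ is the vector subspace parallel to $\langle S\rangle$. A cone is a set $\sum_{i=1}^k\mathbb{R}_+v_i$ with $v_i$ rational; an affine cone is a translate of a cone by a rational point; $\mathcal{C}(W)$ is the set of affine cones in $W$. $\mathcal{F}(\mathfrak{p})$ is the set of (nonempty) faces of $\mathfrak{p}$, including $\mathfrak{p}$ itself. For a face $\mathfrak{f}$ of a polyhedron $\mathfrak{p}$ and $x$ in the relative interior of $\mathfrak{f}$, put $\mathfrak{c}(\mathfrak{p},\mathfrak{f})=\{v: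 x+\epsilon v\in\mathfrak{p}\text{ for }\epsilon>0\text{ small enough}\}$ (independent of $x$). The transverse cone $\mathfrak{t}(\mathfrak{p},\mathfrak{f})$ is the image of $\mathfrak{f}+\mathfrak{c}(\mathfrak{p},\mathfrak{f})$ in $V/\operatorname{lin}(\mathfrak{f})$, an affine cone there. The functions $I$ and $S^L$. For a polyhedron $\mathfrak{p}$ in a rational space $W$, $I(\mathfrak{p})$ is the meromorphic function near $0\in W^*$ which is $0$ if $\mathfrak{p}$ contains a straight line, and otherwise extends $I(\mathfrak{p})(\xi)=\int_{\mathfrak{p}}e^{\langle\xi,x\rangle}dm_{\langle\mathfrak{p}\rangle}(x)$ from those $\xi$ for which $|e^{\langle\xi,x\rangle}|$ is integrable over $\mathfrak{p}$. For a rational subspace $L\subseteq W$, $S^L(\mathfrak{p})$ is the meromorphic function near $0\in W^*$ which is $0$ if $\mathfrak{p}$ contains a straight line, and otherwise extends $$S^L(\mathfrak{p})(\xi)=\sum_{y\in\Lambda_{W/L}}\int_{\mathfrak{p}\cap(y+L)}e^{\langle\xi,x\rangle}dm_L(x)$$ from those $\xi$ for which the sum converges ($y+L$ is the affine subspace above $y\in W/L$, with Lebesgue measure translated from $L$). The map $\mathfrak p\mapsto S^L(\mathfrak p)$ is a valuation. One writes $S=S^{\{0\}}$. The functions $\mu^L$. Given the rational scalar product on $V^*$, there is a unique family of maps $\mu^L=\mu_W^L$, indexed by pairs $(W,L)$ with $W$ a rational quotient space of $V$ and $L$ a rational subspace of $W$, such that: (a) $\mu_W^L$ maps $\mathcal{C}(W)$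 to the space of functions on $W^*$ analytic near $0$; (b) $\mu_{\{0\}}^{\{0\}}(\{0\})=1$; (c) if $\dim W>0$ then $\mu_W^W(\mathfrak{a})=0$ for all $\mathfrak{a}$; (d) if $\mathfrak{a}$ contains a straight line then $\mu_W^L(\mathfrak{a})=0$; (e) for any affine cone $\mathfrak{a}$ in $W$, $S^L(\mathfrak{a})=\sum_{\mathfrak{f}\in\mathcal{F}(\mathfrak{a})}\mu_{W/\operatorname{lin}(\mathfrak{f})}^{(L+\operatorname{lin}(\mathfrak{f}))/\operatorname{lin}(\mathfrak{f})}(\mathfrak{t}(\mathfrak{a},\mathfrak{f}))\,I(\mathfrak{f})$, where functions on $(W/\operatorname{lin}(\mathfrak{f}))^*=\operatorname{lin}(\mathfrak{f})^\perp$ are viewed as functions on $W^*$ via orthogonal projection. The subscript $W$ (here $W=V/\operatorname{lin}(\mathfrak{f})$) is omitted. For every polyhedron $\mathfrak{p}\subset V$, the local Euler-Maclaurin expansion of $S^{(\mathcal{L},\rho)}(\mathfrak{p})$ is $S^{(\mathcal{L},\rho)}(\mathfrak{p})=\sum_{\mathfrak{f}\in\mathcal{F}(\mathfrak{p})}\mu^{(\mathcal{L},\rho)}(\mathfrak{t}(\mathfrak{p},\mathfrak{f}))I(\mathfrak{f})$, and $\mu^{(\mathcal{L},\rho)}(\mathfrak{t}(\mathfrak{p},\mathfrak{f}))$ is called its $\mathfrak{f}$-term; the $\mathfrak{f}$-term of $S(\mathfrak{p})$ is $\mu^{\{0\}}(\mathfrak{t}(\mathfrak{p},\mathfrak{f}))$.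 Patchwork function. Let $\chi(A)$ denote the characteristic function of a set $A$. A patchwork function on a finite family $\mathcal{L}$ of subspaces of $V$ stable under sum is a function $\rho:\mathcal{L}\to\mathbb{Z}$ such that, as functions on $V^*$, $\chi\big(\bigcup_{L\in\mathcal{L}}L^\perp\big)=\sum_{L\in\mathcal{L}}\rho(L)\chi(L^\perp)$. *)

theory Defs
  imports "HOL-Analysis.Analysis" "HOL-Library.Set_Algebras"
begin

text \<open>
  The ambient vector space \<open>V\<close> is the whole type \<^typ>\<open>'a\<close> (of finite dimension, possibly \<open>0\<close>); its
  norm only serves to provide the topology.  The dual space of \<open>V\<close> is \<open>'a \<Rightarrow>\<^sub>L real\<close> and the
  complexified dual is \<open>'a \<Rightarrow>\<^sub>L complex\<close>; the germs of analytic and meromorphic functions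
  below live on (subspaces of) the latter.

  A rational quotient space \<open>W = V/K\<close> is represented by the rational subspace \<open>K\<close>, a subset of
  \<open>V/K\<close> by its preimage in \<open>V\<close> (a union of cosets of \<open>K\<close>), and the dual of \<open>V/K\<close> by the
  annihilator of \<open>K\<close>.  Thus a subspace of \<open>V/K\<close> is given by a subspace \<open>L \<supseteq> K\<close> of \<open>V\<close>, and
  \<open>(V/K)/(L/K)\<close> is \<open>V/L\<close>.  Affine spans, faces, relative interiors, the spaces \<open>lin\<close> and
  the cones of feasible directions all commute with taking preimages.
\<close>


subsection \<open>Rational spaces\<close>

definition is_lattice_in :: "'a::real_normed_vector set \<Rightarrow> 'a set \<Rightarrow> bool" where
  "is_lattice_in L \<Gamma> \<longleftrightarrow>
     0 \<in> \<Gamma> \<and> (\<forall>x\<in>\<Gamma>. \<forall>y\<in>\<Gamma>. x - y \<in> \<Gamma>) \<and> discrete \<Gamma> \<and> span \<Gamma> = L"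

definition rational_space :: "'a::real_normed_vector set \<Rightarrow> bool" where
  "rational_space \<Lambda> \<longleftrightarrow>
     (\<exists>B::'a set. finite B \<and> span B = UNIV) \<and> is_lattice_in UNIV \<Lambda>"

definition rational_point :: "'a::real_normed_vector set \<Rightarrow> 'a \<Rightarrow> bool" where
  "rational_point \<Lambda> x \<longleftrightarrow> (\<exists>q::int. q \<noteq> 0 \<and> of_int q *\<^sub>R x \<in> \<Lambda>)"

definition rational_subspace :: "'a::real_normed_vector set \<Rightarrow> 'a set \<Rightarrow> bool" where
  "rational_subspace \<Lambda> L \<longleftrightarrow> subspace L \<and> is_lattice_in L (L \<inter> \<Lambda>)"

definition rational_affine :: "'a::real_normed_vector set \<Rightarrow> 'a set \<Rightarrow> bool" where
  "rational_affine \<Lambda> A \<longleftrightarrow>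
     (\<exists>x L. rational_point \<Lambda> x \<and> rational_subspace \<Lambda> L \<and> A = (+) x ` L)"

definition dual_lattice :: "'a::real_normed_vector set \<Rightarrow> ('a \<Rightarrow>\<^sub>L real) set" where
  "dual_lattice \<Lambda> = {\<xi>. \<forall>x\<in>\<Lambda>. blinfun_apply \<xi> x \<in> \<int>}"

definition rational_scalar_product ::
    "'a::real_normed_vector set \<Rightarrow> (('a \<Rightarrow>\<^sub>L real) \<Rightarrow> ('a \<Rightarrow>\<^sub>L real) \<Rightarrow> real) \<Rightarrow> bool" where
  "rational_scalar_product \<Lambda> Q \<longleftrightarrow>
     bilinear Q \<and> (\<forall>\<xi> \<eta>. Q \<xi> \<eta> = Q \<eta> \<xi>) \<and> (\<forall>\<xi>. \<xi> \<noteq> 0 \<longrightarrow> 0 < Q \<xi> \<xi>) \<and>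
     (\<forall>\<xi> \<eta>. rational_point (dual_lattice \<Lambda>) \<xi> \<longrightarrow> rational_point (dual_lattice \<Lambda>) \<eta> \<longrightarrow>
        Q \<xi> \<eta> \<in> \<rat>)"

text \<open>With \<open>'b = real\<close> this is \<open>L\<^sup>\<bottom>\<close>, with \<open>'b = complex\<close> its complexification.\<close>
definition annihilator ::
    "'a::real_normed_vector set \<Rightarrow> ('a \<Rightarrow>\<^sub>L 'b::real_normed_vector) set" where
  "annihilator L = {\<xi>. \<forall>x\<in>L. blinfun_apply \<xi> x = 0}"

text \<open>
  Complexification of the orthogonal projection of the dual of \<open>V\<close> onto the annihilator of \<open>M\<close>,
  obtained by projecting real and imaginary parts.
\<close>
definition orth_proj ::
    "(('a::real_normed_vector \<Rightarrow>\<^sub>L real) \<Rightarrow> ('a \<Rightarrow>\<^sub>L real) \<Rightarrow> real) \<Rightarrow> 'a set \<Rightarrow>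
      ('a \<Rightarrow>\<^sub>L complex) \<Rightarrow> ('a \<Rightarrow>\<^sub>L complex)" where
  "orth_proj Q M \<xi> = (THE \<eta>. \<eta> \<in> annihilator M \<and>
     (\<forall>\<zeta>\<in>annihilator M. Q (Blinfun Re o\<^sub>L (\<xi> - \<eta>)) \<zeta> = 0 \<and> Q (Blinfun Im o\<^sub>L (\<xi> - \<eta>)) \<zeta> = 0))"


subsection \<open>Polyhedra, cones and faces\<close>

definition rational_halfspace :: "'a::real_normed_vector set \<Rightarrow> 'a set \<Rightarrow> bool" where
  "rational_halfspace \<Lambda> H \<longleftrightarrow>
     (\<exists>(\<alpha>::'a \<Rightarrow>\<^sub>L real) c. \<alpha> \<noteq> 0 \<and> rational_affine \<Lambda> {x. blinfun_apply \<alpha> x = c} \<and>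
        H = {x. blinfun_apply \<alpha> x \<le> c})"

definition rational_polyhedron :: "'a::real_normed_vector set \<Rightarrow> 'a set \<Rightarrow> bool" where
  "rational_polyhedron \<Lambda> p \<longleftrightarrow>
     (\<exists>\<H>. finite \<H> \<and> (\<forall>H\<in>\<H>. rational_halfspace \<Lambda> H) \<and> p = \<Inter>\<H>)"

definition cone_gen :: "'a::real_vector set \<Rightarrow> 'a set" where
  "cone_gen F = {\<Sum>v\<in>F. c v *\<^sub>R v | c. \<forall>v\<in>F. 0 \<le> c v}"

text \<open>
  \<open>\<C>(V/K)\<close>.  The rational points of \<open>V/K\<close> are the images of the rational points of \<open>V\<close>, so
  vertices and generators can be taken in \<open>V\<close>.
\<close>
definition affine_cones :: "'a::real_normed_vector set \<Rightarrow> 'a set \<Rightarrow> 'a set set" where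
  "affine_cones \<Lambda> K = {(+) s ` (cone_gen F + K) | s F.
     rational_point \<Lambda> s \<and> finite F \<and> (\<forall>v\<in>F. rational_point \<Lambda> v)}"

definition lin :: "'a::real_vector set \<Rightarrow> 'a set" where
  "lin S = {x - y | x y. x \<in> affine hull S \<and> y \<in> affine hull S}"

definition faces :: "'a::real_vector set \<Rightarrow> 'a set set" where
  "faces p = {f. f face_of p \<and> f \<noteq> {}}"

definition feasible_cone :: "'a::real_normed_vector set \<Rightarrow> 'a set \<Rightarrow> 'a set" where
  "feasible_cone p f = {v. \<exists>x\<in>rel_interior f. \<forall>\<^sub>F \<epsilon> in at_right 0. x + \<epsilon> *\<^sub>R v \<in> p}"

text \<open>
  The preimage in \<open>V\<close> of the image of \<open>f + \<cc>(p,f)\<close> in the quotient by \<open>lin f\<close>.  If \<open>p\<close>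
  represents a subset of \<open>V/K\<close>, the quotient \<open>(V/K)/lin\<close> is again \<open>V/lin f\<close>.
\<close>
definition transverse_cone :: "'a::real_normed_vector set \<Rightarrow> 'a set \<Rightarrow> 'a set" where
  "transverse_cone p f = f + feasible_cone p f + lin f"

text \<open>The image of \<open>p\<close> in \<open>V/K\<close> contains a straight line.\<close>
definition contains_line :: "'a::real_vector set \<Rightarrow> 'a set \<Rightarrow> bool" where
  "contains_line K p \<longleftrightarrow> (\<exists>x v. v \<notin> K \<and> (\<forall>t::real. x + t *\<^sub>R v \<in> p))"


subsection \<open>Lebesgue measures normalised by the lattice\<close>

text \<open>The images of the elements of \<open>B\<close> form a \<open>\<int>\<close>-basis of the lattice of \<open>L/K\<close>.\<close>
definition quot_lattice_basis ::
    "'a::real_normed_vector set \<Rightarrow> 'a set \<Rightarrow> 'a set \<Rightarrow> 'a set \<Rightarrow> bool" where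
  "quot_lattice_basis \<Lambda> K L B \<longleftrightarrow> finite B \<and> B \<subseteq> L \<inter> \<Lambda> \<and>
     (\<forall>x\<in>L \<inter> \<Lambda>. \<exists>n::'a \<Rightarrow> int. x - (\<Sum>b\<in>B. of_int (n b) *\<^sub>R b) \<in> K) \<and>
     (\<forall>c::'a \<Rightarrow> real. (\<Sum>b\<in>B. c b *\<^sub>R b) \<in> K \<longrightarrow> (\<forall>b\<in>B. c b = 0))"

text \<open>
  The Lebesgue measure on \<open>L/K\<close> giving measure \<open>1\<close> to a fundamental parallelotope of the lattice,
  transported to a complement of \<open>K\<close> in \<open>L\<close> spanned by lattice vectors.  The integral of a
  \<open>K\<close>-invariant function does not depend on the choice of the basis.
\<close>
definition lattice_measure ::
    "'a::real_normed_vector set \<Rightarrow> 'a set \<Rightarrow> 'a set \<Rightarrow> 'a measure" where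
  "lattice_measure \<Lambda> K L =
     (let B = SOME B. quot_lattice_basis \<Lambda> K L B
      in distr (\<Pi>\<^sub>M b\<in>B. lborel) borel (\<lambda>t. \<Sum>b\<in>B. t b *\<^sub>R b))"

definition affine_measure ::
    "'a::real_normed_vector set \<Rightarrow> 'a set \<Rightarrow> 'a set \<Rightarrow> 'a measure" where
  "affine_measure \<Lambda> K A =
     distr (lattice_measure \<Lambda> K (lin A)) borel (\<lambda>x. (SOME a. a \<in> A) + x)"


subsection \<open>Germs at the origin of analytic and meromorphic functions\<close>

text \<open>Here \<open>E\<close> is a complex subspace of the complexified dual, the annihilator of some \<open>K\<close>.\<close>

definition near0 :: "'b::real_normed_vector set \<Rightarrow> ('b \<Rightarrow> bool) \<Rightarrow> bool" where
  "near0 E P \<longleftrightarrow> (\<forall>\<^sub>F \<xi> in nhds 0. \<xi> \<in> E \<longrightarrow> P \<xi>)"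

definition germ_eq ::
    "'b::real_normed_vector set \<Rightarrow> ('b \<Rightarrow> complex) \<Rightarrow> ('b \<Rightarrow> complex) \<Rightarrow> bool" where
  "germ_eq E F G \<longleftrightarrow> near0 E (\<lambda>\<xi>. F \<xi> = G \<xi>)"

text \<open>Complex differentiability on a neighbourhood of the origin of \<open>E\<close>.\<close>
definition analytic_near0 ::
    "('a::real_normed_vector \<Rightarrow>\<^sub>L complex) set \<Rightarrow> (('a \<Rightarrow>\<^sub>L complex) \<Rightarrow> complex) \<Rightarrow> bool" where
  "analytic_near0 E F \<longleftrightarrow> near0 E (\<lambda>\<xi>. \<exists>D. (F has_derivative D) (at \<xi> within E) \<and>
     (\<forall>c. \<forall>\<eta>\<in>E. D (blinfun_mult_right c o\<^sub>L \<eta>) = c * D \<eta>))"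

text \<open>
  \<open>h\<close> represents the germ of the meromorphic function \<open>u / w\<close> which extends the function \<open>\<phi>\<close>
  on \<open>D\<close>; the values of \<open>h\<close> at zeros of \<open>w\<close> are irrelevant.
\<close>
definition mero_extends ::
    "('a::real_normed_vector \<Rightarrow>\<^sub>L complex) set \<Rightarrow> ('a \<Rightarrow>\<^sub>L complex) set \<Rightarrow>
      (('a \<Rightarrow>\<^sub>L complex) \<Rightarrow> complex) \<Rightarrow> (('a \<Rightarrow>\<^sub>L complex) \<Rightarrow> complex) \<Rightarrow> bool" where
  "mero_extends E D \<phi> h \<longleftrightarrow>
     (\<exists>u w. analytic_near0 E u \<and> analytic_near0 E w \<and> \<not> germ_eq E w (\<lambda>_. 0) \<and>
        near0 E (\<lambda>\<xi>. (w \<xi> \<noteq> 0 \<longrightarrow> h \<xi> = u \<xi> / w \<xi>) \<and> (\<xi> \<in> D \<longrightarrow> u \<xi> = w \<xi> * \<phi> \<xi>)))"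

text \<open>Equality of germs of meromorphic functions: equality off an analytic hypersurface.\<close>
definition mero_eq ::
    "('a::real_normed_vector \<Rightarrow>\<^sub>L complex) set \<Rightarrow>
      (('a \<Rightarrow>\<^sub>L complex) \<Rightarrow> complex) \<Rightarrow> (('a \<Rightarrow>\<^sub>L complex) \<Rightarrow> complex) \<Rightarrow> bool" where
  "mero_eq E g h \<longleftrightarrow>
     (\<exists>w. analytic_near0 E w \<and> \<not> germ_eq E w (\<lambda>_. 0) \<and>
        near0 E (\<lambda>\<xi>. w \<xi> \<noteq> 0 \<longrightarrow> g \<xi> = h \<xi>))"


subsection \<open>The functions \<open>I\<close> and \<open>S\<^sup>L\<close>\<close>

definition I_domain ::
    "'a::real_normed_vector set \<Rightarrow> 'a set \<Rightarrow> 'a set \<Rightarrow> ('a \<Rightarrow>\<^sub>L complex) set" where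
  "I_domain \<Lambda> K p = {\<xi>. set_integrable (affine_measure \<Lambda> K (affine hull p)) p
     (\<lambda>x. cmod (exp (blinfun_apply \<xi> x)))}"

definition I_integral ::
    "'a::real_normed_vector set \<Rightarrow> 'a set \<Rightarrow> 'a set \<Rightarrow> ('a \<Rightarrow>\<^sub>L complex) \<Rightarrow> complex" where
  "I_integral \<Lambda> K p \<xi> =
     (LINT x:p|affine_measure \<Lambda> K (affine hull p). exp (blinfun_apply \<xi> x))"

text \<open>\<open>I(p)\<close> for a polyhedron \<open>p\<close> in \<open>V/K\<close>, well-defined up to \<^const>\<open>mero_eq\<close>.\<close>
definition I_fun ::
    "'a::real_normed_vector set \<Rightarrow> 'a set \<Rightarrow> 'a set \<Rightarrow> ('a \<Rightarrow>\<^sub>L complex) \<Rightarrow> complex" where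
  "I_fun \<Lambda> K p =
     (if contains_line K p then (\<lambda>_. 0)
      else SOME h. mero_extends (annihilator K) (I_domain \<Lambda> K p) (I_integral \<Lambda> K p) h)"

text \<open>The lattice of \<open>V/L\<close>, as a set of cosets.\<close>
definition lattice_cosets :: "'a::real_normed_vector set \<Rightarrow> 'a set \<Rightarrow> 'a set set" where
  "lattice_cosets \<Lambda> L = (\<lambda>y. (+) y ` L) ` \<Lambda>"

definition S_domain ::
    "'a::real_normed_vector set \<Rightarrow> 'a set \<Rightarrow> 'a set \<Rightarrow> 'a set \<Rightarrow> ('a \<Rightarrow>\<^sub>L complex) set" where
  "S_domain \<Lambda> K L p = {\<xi>.
     (\<forall>A\<in>lattice_cosets \<Lambda> L.
        set_integrable (affine_measure \<Lambda> K A) (p \<inter> A) (\<lambda>x. cmod (exp (blinfun_apply \<xi> x)))) \<and>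
     (\<lambda>A. LINT x:p \<inter> A|affine_measure \<Lambda> K A. cmod (exp (blinfun_apply \<xi> x)))
       summable_on lattice_cosets \<Lambda> L}"

definition S_sum ::
    "'a::real_normed_vector set \<Rightarrow> 'a set \<Rightarrow> 'a set \<Rightarrow> 'a set \<Rightarrow> ('a \<Rightarrow>\<^sub>L complex) \<Rightarrow> complex" where
  "S_sum \<Lambda> K L p \<xi> =
     (\<Sum>\<^sub>\<infinity>A\<in>lattice_cosets \<Lambda> L. LINT x:p \<inter> A|affine_measure \<Lambda> K A. exp (blinfun_apply \<xi> x))"

text \<open>\<open>S\<^sup>L\<^sup>/\<^sup>K(p)\<close> for a polyhedron \<open>p\<close> in \<open>V/K\<close>, well-defined up to \<^const>\<open>mero_eq\<close>.\<close>
definition S_fun ::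
    "'a::real_normed_vector set \<Rightarrow> 'a set \<Rightarrow> 'a set \<Rightarrow> 'a set \<Rightarrow> ('a \<Rightarrow>\<^sub>L complex) \<Rightarrow> complex" where
  "S_fun \<Lambda> K L p =
     (if contains_line K p then (\<lambda>_. 0)
      else SOME h. mero_extends (annihilator K) (S_domain \<Lambda> K L p) (S_sum \<Lambda> K L p) h)"


subsection \<open>The functions \<open>\<mu>\<^sup>L\<close>\<close>

text \<open>
  \<open>\<mu> K L a\<close> is \<open>\<mu>\<^sub>W\<^sup>M(a)\<close> for \<open>W = V/K\<close> and \<open>M = L/K\<close>, a germ on the annihilator of \<open>K\<close>.  In
  particular \<open>\<mu> K K\<close> is \<open>\<mu>\<^sup>{\<^sup>0\<^sup>}\<close> on \<open>V/K\<close>, \<open>\<mu> K UNIV\<close> is \<open>\<mu>\<^sup>W\<close> and \<open>\<mu> UNIV UNIV\<close> belongs to the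
  quotient \<open>{0}\<close>.
\<close>
type_synonym 'a mu_family =
  "'a set \<Rightarrow> 'a set \<Rightarrow> 'a set \<Rightarrow> ('a \<Rightarrow>\<^sub>L complex) \<Rightarrow> complex"

definition is_mu_family ::
    "'a::real_normed_vector set \<Rightarrow> (('a \<Rightarrow>\<^sub>L real) \<Rightarrow> ('a \<Rightarrow>\<^sub>L real) \<Rightarrow> real) \<Rightarrow>
      'a mu_family \<Rightarrow> bool" where
  "is_mu_family \<Lambda> Q \<mu> \<longleftrightarrow>
     germ_eq (annihilator UNIV) (\<mu> UNIV UNIV UNIV) (\<lambda>_. 1) \<and>
     (\<forall>K L a. rational_subspace \<Lambda> K \<and> rational_subspace \<Lambda> L \<and> K \<subseteq> L \<and> a \<in> affine_cones \<Lambda> K \<longrightarrow>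
        analytic_near0 (annihilator K) (\<mu> K L a) \<and>
        (K \<noteq> UNIV \<and> L = UNIV \<longrightarrow> germ_eq (annihilator K) (\<mu> K L a) (\<lambda>_. 0)) \<and>
        (contains_line K a \<longrightarrow> germ_eq (annihilator K) (\<mu> K L a) (\<lambda>_. 0)) \<and>
        mero_eq (annihilator K) (S_fun \<Lambda> K L a)
          (\<lambda>\<xi>. \<Sum>f\<in>faces a.
             \<mu> (lin f) (L + lin f) (transverse_cone a f) (orth_proj Q (lin f) \<xi>) * I_fun \<Lambda> K f \<xi>))"


subsection \<open>Patchwork functions\<close>

definition patchwork_function ::
    "'a::real_normed_vector set set \<Rightarrow> ('a set \<Rightarrow> int) \<Rightarrow> bool" where
  "patchwork_function \<L> \<rho> \<longleftrightarrow>
     (\<forall>\<xi>::'a \<Rightarrow>\<^sub>L real. indicator (\<Union>L\<in>\<L>. annihilator L) \<xi> =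
        (\<Sum>L\<in>\<L>. \<rho> L * indicator (annihilator L) \<xi>))"

text \<open>\<open>\<mu>\<^sup>(\<^sup>\<L>\<^sup>,\<^sup>\<rho>\<^sup>)(\<tt>(p,f))\<close>, the \<open>f\<close>-term in the expansion of \<open>S\<^sup>(\<^sup>\<L>\<^sup>,\<^sup>\<rho>\<^sup>)(p) = (\<Sum>L\<in>\<L>. \<rho> L * S\<^sup>L(p))\<close>.\<close>
definition mu_patchwork ::
    "'a::real_normed_vector mu_family \<Rightarrow> 'a set set \<Rightarrow> ('a set \<Rightarrow> int) \<Rightarrow> 'a set \<Rightarrow> 'a set \<Rightarrow>
      ('a \<Rightarrow>\<^sub>L complex) \<Rightarrow> complex" where
  "mu_patchwork \<mu> \<L> \<rho> p f \<xi> =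
     (\<Sum>L\<in>\<L>. of_int (\<rho> L) * \<mu> (lin f) (L + lin f) (transverse_cone p f) \<xi>)"

end

theory Submission
  imports Defs
begin

text \<open>
  Put \<open>K = lin f\<close>.  Since \<open>K \<in> \<L>\<close>, restricting the patchwork identity to \<open>K\<^sup>\<bottom>\<close> gives
  \<open>\<chi>(K\<^sup>\<bottom>) = (\<Sum>L\<in>\<L>. \<rho>(L) \<chi>((L + K)\<^sup>\<bottom>))\<close>.  Characteristic functions of distinct
  subspaces are linearly independent, because a real vector space is not a finite union of
  proper subspaces.  Hence the sum of \<open>\<rho>(L)\<close> over all \<open>L\<close> with \<open>L + K = M\<close> is \<open>1\<close> for
  \<open>M = K\<close> and \<open>0\<close> otherwise, and grouping the \<open>f\<close>-term by \<open>M = L + K\<close> leaves only \<open>M = K\<close>.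
\<close>

text \<open>All norms on a finite dimensional space are equivalent: on coefficient vectors of sup
  norm 1 the norm of the linear combination has a positive minimum, by compactness and independence.
  Dimension is expressed by a finite spanning set, since \<open>'a\<close> is merely a normed space;
  the lemma puts every linear functional into the dual.\<close>

lemma linear_bounded_finite_dim:
  fixes g :: "'a::real_normed_vector \<Rightarrow> 'b::real_normed_vector"
  assumes "finite F" "span F = (UNIV::'a set)" and g: "linear g"
  shows "bounded_linear g"
proof -
  obtain B where B: "B \<subseteq> F" "independent B" "span B = UNIV"
    using assms(2) by (metis maximal_independent_subset span_mono span_span top.extremum_uniqueI)
  have fB: "finite B"
    using B(1) assms(1) finite_subset by blast
  \<comment> \<open>\<open>S b\<close> is the pair of opposite faces of the unit cube on which
    coordinate \<open>b\<close> is -1 or 1. The faces together form the sup norm sphere, and each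
    pair is a product of compact sets.\<close>
  define S where "S b = PiE B (\<lambda>x. if x = b then {-1, 1::real} else {-1..1})" for b
  define T where "T c = (\<Sum>b\<in>B. c b *\<^sub>R b)" for c :: "'a \<Rightarrow> real"
  have lower: "\<exists>m>0. \<forall>c\<in>S b. m \<le> norm (T c)" if b: "b \<in> B" for b
  proof -
    \<comment> \<open>Rewriting \<open>S b\<close> as a product over all indices, with the singleton
      \<open>{undefined}\<close> outside \<open>B\<close>, makes Tychonoff's theorem apply in the
      function space.\<close>
    have "compactin (product_topology (\<lambda>_. euclidean) UNIV)
        (PiE UNIV (\<lambda>x. if x \<in> B then if x = b then {-1, 1::real} else {-1..1} else {undefined}))"
      by (subst compactin_PiE) auto
    moreover have "PiE UNIV (\<lambda>x. if x \<in> B then if x = b then {-1, 1::real} else {-1..1} else {undefined})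
        = S b"
      unfolding S_def PiE_def Pi_def extensional_def by (auto split: if_splits)
    ultimately have cpt: "compact (S b)"
      by (simp add: euclidean_product_topology)
    have ne: "S b \<noteq> {}"
      unfolding S_def PiE_eq_empty_iff by auto
    have cont: "continuous_on (S b) (\<lambda>c. norm (T c))"
      unfolding T_def
      by (intro continuous_intros continuous_on_subset[OF continuous_on_product_coordinates]) auto
    obtain c where c: "c \<in> S b" "\<And>d. d \<in> S b \<Longrightarrow> norm (T c) \<le> norm (T d)"
      using continuous_attains_inf[OF cpt ne cont] by blast
    have "c b \<noteq> 0"
      using c(1) b unfolding S_def PiE_iff by force
    then have "T c \<noteq> 0"
      using B(2) b fB unfolding T_def by (auto simp: dependent_finite)
    then show ?thesis
      using c by (intro exI[of _ "norm (T c)"]) auto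
  qed
  then obtain m where m: "\<And>b. b \<in> B \<Longrightarrow> m b > 0" "\<And>b c. b \<in> B \<Longrightarrow> c \<in> S b \<Longrightarrow> m b \<le> norm (T c)"
    by metis
  define C where "C = (\<Sum>b\<in>B. norm (g b) / m b)"
  \<comment> \<open>The first factor bounds \<open>g v\<close> by the largest coefficient of
    \<open>v\<close>; the second bounds that coefficient by \<open>norm v\<close>, whichever
    \<open>b\<close> attains the maximum.\<close>
  define D where "D = (\<Sum>b\<in>B. norm (g b)) * (\<Sum>b\<in>B. 1 / m b)"
  show ?thesis
  proof (rule bounded_linear_intro[of _ D])
    fix x y and r :: real
    show "g (x + y) = g x + g y" "g (r *\<^sub>R x) = r *\<^sub>R g x"
      using g by (simp_all add: linear_add linear_cmul)
  next
    fix v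
    obtain c where c: "v = T c"
      using B(3) fB span_finite[OF fB] unfolding T_def by (metis (no_types, lifting) UNIV_I rangeE)
    show "norm (g v) \<le> norm v * D"
    proof (cases "\<exists>b\<in>B. c b \<noteq> 0")
      case False
      then have "v = 0"
        unfolding c T_def by simp
      then show ?thesis
        using g by (simp add: linear_0)
    next
      case True
      define M where "M = Max ((\<lambda>b. \<bar>c b\<bar>) ` B)"
      have le: "\<bar>c b\<bar> \<le> M" if "b \<in> B" for b
        unfolding M_def using that fB by simp
      then have M0: "M > 0"
        using True by force
      obtain b where b: "b \<in> B" "\<bar>c b\<bar> = M"
        using Max_in[of "(\<lambda>b. \<bar>c b\<bar>) ` B"] fB True unfolding M_def by fastforce
      \<comment> \<open>Dividing by the largest modulus moves the coefficients onto the faces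
        \<open>S b\<close>; \<open>restrict\<close> supplies the extensionality required by
        \<open>PiE\<close>.\<close>
      define d where "d = restrict (\<lambda>x. c x / M) B"
      have "d b = 1 \<or> d b = -1"
        using b M0 by (auto simp: d_def abs_if field_simps split: if_splits)
      moreover have "d x \<in> {-1..1}" if "x \<in> B" for x
        using le[OF that] M0 that unfolding d_def by (simp add: abs_le_iff field_simps)
      moreover have "d \<in> extensional B"
        unfolding d_def by simp
      ultimately have "d \<in> S b"
        unfolding S_def PiE_iff by auto
      then have "m b \<le> norm (T d)"
        using m b by blast
      also have "T d = (1 / M) *\<^sub>R v"
        unfolding c T_def d_def scaleR_sum_right by (intro sum.cong) auto
      finally have "M * m b \<le> norm v"
        using M0 by (simp add: field_simps)
      then have "M \<le> norm v * (1 / m b)"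
        using m(1)[OF b(1)] by (simp add: field_simps)
      also have "\<dots> \<le> norm v * (\<Sum>b\<in>B. 1 / m b)"
        using b fB m(1) by (intro mult_left_mono member_le_sum) (auto intro: less_imp_le)
      finally have M: "M \<le> norm v * (\<Sum>b\<in>B. 1 / m b)" .
      have "norm (g v) = norm (\<Sum>b\<in>B. c b *\<^sub>R g b)"
        unfolding c T_def using g by (simp add: linear_sum linear_cmul)
      also have "\<dots> \<le> (\<Sum>b\<in>B. M * norm (g b))"
        by (intro sum_norm_le) (auto intro!: mult_right_mono le)
      also have "\<dots> = M * (\<Sum>b\<in>B. norm (g b))"
        by (simp add: sum_distrib_left)
      also have "\<dots> \<le> norm v * (\<Sum>b\<in>B. 1 / m b) * (\<Sum>b\<in>B. norm (g b))"
        by (intro mult_right_mono M sum_nonneg) auto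
      finally show ?thesis
        unfolding D_def by (simp add: mult_ac)
    qed
  qed
qed

text \<open>Adjoining \<open>x\<close> to a basis of \<open>M\<close> keeps it independent, so a
  functional may be prescribed as 0 on the basis and 1 at \<open>x\<close>; finite dimension makes
  it bounded.\<close>

lemma annihilator_separates_point:
  fixes M :: "'a::real_normed_vector set"
  assumes "finite F" "span F = (UNIV::'a set)" and M: "subspace M" "x \<notin> M"
  obtains \<eta> :: "'a \<Rightarrow>\<^sub>L real" where "\<eta> \<in> annihilator M" "blinfun_apply \<eta> x = 1"
proof -
  obtain C where C: "C \<subseteq> M" "independent C" "span C = M"
    using M(1) by (metis maximal_independent_subset span_subspace)
  have "independent (insert x C)"
    using C M by (simp add: independent_insertI)
  then obtain g :: "'a \<Rightarrow> real" where g: "linear g" "\<forall>y\<in>insert x C. g y = (if y = x then 1 else 0)"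
    using linear_independent_extend[of _ "\<lambda>y. if y = x then 1 else 0"] by blast
  have "g y = 0" if "y \<in> M" for y
    using that C M g linear_eq_0_on_span[OF g(1), of C] by (metis (full_types) insertI2 subset_iff)
  moreover have "bounded_linear g"
    using linear_bounded_finite_dim assms(1,2) g(1) by blast
  ultimately show thesis
    using that[of "Blinfun g"] g(2) by (auto simp: annihilator_def bounded_linear_Blinfun_apply)
qed

text \<open>Each point outside \<open>M\<close> excludes a proper subspace of the annihilator, and
  finitely many of these do not exhaust it. The induction moves along a line
  \<open>\<xi> + t *\<^sub>R \<eta>\<close>, on which each point rules out at most one
  \<open>t\<close>.\<close>

lemma annihilator_separates_finite:
  fixes M :: "'a::real_normed_vector set"
  assumes F: "finite F" "span F = (UNIV::'a set)" and M: "subspace M"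
    and X: "finite X" "X \<inter> M = {}"
  shows "\<exists>\<xi>\<in>(annihilator M :: ('a \<Rightarrow>\<^sub>L real) set). \<forall>x\<in>X. blinfun_apply \<xi> x \<noteq> 0"
  using X
proof (induction X)
  case empty
  have "0 \<in> (annihilator M :: ('a \<Rightarrow>\<^sub>L real) set)"
    by (simp add: annihilator_def)
  then show ?case
    by blast
next
  case (insert x X)
  then obtain \<xi> :: "'a \<Rightarrow>\<^sub>L real"
    where \<xi>: "\<xi> \<in> annihilator M" "\<forall>y\<in>X. blinfun_apply \<xi> y \<noteq> 0"
    by auto
  obtain \<eta> :: "'a \<Rightarrow>\<^sub>L real" where \<eta>: "\<eta> \<in> annihilator M" "blinfun_apply \<eta> x = 1"
    using annihilator_separates_point[OF F M, of x] insert.prems by auto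
  \<comment> \<open>These are the parameters at which the perturbed functional vanishes at some
    point. If \<eta> vanishes at \<open>y\<close>, division by zero merely adds 0 to
    \<open>R\<close>; then \<open>y\<close> differs from \<open>x\<close>, and \<xi> alone is
    nonzero there.\<close>
  define R where "R = (\<lambda>y. - blinfun_apply \<xi> y / blinfun_apply \<eta> y) ` insert x X"
  have "finite R"
    unfolding R_def using insert.hyps by simp
  then obtain t where "t \<notin> R"
    using ex_new_if_finite[OF infinite_UNIV_char_0] by blast
  then have t: "\<And>y. y \<in> insert x X \<Longrightarrow> t \<noteq> - blinfun_apply \<xi> y / blinfun_apply \<eta> y"
    unfolding R_def by auto
  have "blinfun_apply (\<xi> + t *\<^sub>R \<eta>) y \<noteq> 0" if y: "y \<in> insert x X" for y
  proof (cases "blinfun_apply \<eta> y = 0")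
    case True
    then show ?thesis
      using y \<eta>(2) \<xi>(2) by (auto simp: blinfun.bilinear_simps)
  next
    case False
    then show ?thesis
      using t[OF y] by (auto simp: blinfun.bilinear_simps field_simps eq_neg_iff_add_eq_0)
  qed
  moreover have "\<xi> + t *\<^sub>R \<eta> \<in> annihilator M"
    using \<xi>(1) \<eta>(1) by (simp add: annihilator_def blinfun.bilinear_simps)
  ultimately show ?case
    by blast
qed

text \<open>Among the subspaces with nonzero coefficient take a minimal \<open>M\<close>. Its
  annihilator is not covered by the annihilators of the others, and evaluating at a functional
  outside all of those isolates \<open>c M\<close>.\<close>

lemma indicator_annihilator_independent:
  fixes \<S> :: "'a::real_normed_vector set set" and c :: "'a set \<Rightarrow> 'c::semiring_1"
  assumes F: "finite F" "span F = (UNIV::'a set)"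
    and \<S>: "finite \<S>" "\<And>M. M \<in> \<S> \<Longrightarrow> subspace M"
    and zero: "\<And>\<xi>::'a \<Rightarrow>\<^sub>L real. (\<Sum>M\<in>\<S>. c M * indicator (annihilator M) \<xi>) = 0"
    and "M \<in> \<S>"
  shows "c M = 0"
proof (rule ccontr)
  assume "c M \<noteq> 0"
  then have "finite {M\<in>\<S>. c M \<noteq> 0}" "{M\<in>\<S>. c M \<noteq> 0} \<noteq> {}"
    using \<S>(1) \<open>M \<in> \<S>\<close> by auto
  then obtain M where M: "M \<in> \<S>" "c M \<noteq> 0"
    and min: "\<And>N. N \<in> \<S> \<Longrightarrow> c N \<noteq> 0 \<Longrightarrow> N \<subseteq> M \<Longrightarrow> N = M"
    using finite_has_minimal[of "{M\<in>\<S>. c M \<noteq> 0}"] by (metis (mono_tags, lifting) mem_Collect_eq)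
  define \<N> where "\<N> = {N\<in>\<S>. c N \<noteq> 0 \<and> N \<noteq> M}"
  \<comment> \<open>By minimality no other \<open>N\<close> lies inside \<open>M\<close>. A
    functional that is nonzero at the chosen point of \<open>N\<close> is outside the annihilator of
    \<open>N\<close>.\<close>
  have "\<forall>N\<in>\<N>. \<exists>x. x \<in> N \<and> x \<notin> M"
    using min unfolding \<N>_def by blast
  then obtain x where x: "\<And>N. N \<in> \<N> \<Longrightarrow> x N \<in> N \<and> x N \<notin> M"
    by metis
  have "finite (x ` \<N>)" "x ` \<N> \<inter> M = {}"
    using \<S>(1) x unfolding \<N>_def by auto
  then obtain \<xi> :: "'a \<Rightarrow>\<^sub>L real"
    where \<xi>: "\<xi> \<in> annihilator M" "\<And>N. N \<in> \<N> \<Longrightarrow> blinfun_apply \<xi> (x N) \<noteq> 0"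
    using annihilator_separates_finite[OF F \<S>(2)[OF M(1)]] by (metis imageI)
  have "c N * indicator (annihilator N) \<xi> = 0" if "N \<in> \<S> - {M}" for N
  proof (cases "c N = 0")
    case False
    then have "N \<in> \<N>"
      using that unfolding \<N>_def by simp
    then have "\<xi> \<notin> annihilator N"
      using \<xi>(2) x unfolding annihilator_def by blast
    then show ?thesis
      by simp
  qed simp
  then have "(\<Sum>N\<in>\<S>. c N * indicator (annihilator N) \<xi>) = c M"
    using sum.remove[OF \<S>(1) M(1), of "\<lambda>N. c N * indicator (annihilator N) \<xi>"] \<xi>(1) by simp
  then show False
    using zero M(2) by metis
qed

lemma annihilator_sum:
  assumes "0 \<in> L" "0 \<in> K"
  shows "annihilator (L + K) = annihilator L \<inter> annihilator K"
proof -
  have "L \<subseteq> L + K" "K \<subseteq> L + K"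
    using assms by (auto simp: set_plus_def) (metis add.right_neutral, metis add.left_neutral)
  then show ?thesis
    by (fastforce simp: annihilator_def blinfun.add_right elim: set_plus_elim)
qed

lemma patchwork_sum_fiber:
  fixes \<L> :: "'a::real_normed_vector set set"
  assumes F: "finite F" "span F = (UNIV::'a set)"
    and \<L>: "finite \<L>" "\<And>L. L \<in> \<L> \<Longrightarrow> subspace L" "\<And>L M. L \<in> \<L> \<Longrightarrow> M \<in> \<L> \<Longrightarrow> L + M \<in> \<L>"
    and \<rho>: "patchwork_function \<L> \<rho>" and K: "K \<in> \<L>" and M: "M \<in> \<L>"
  shows "(\<Sum>L | L \<in> \<L> \<and> L + K = M. \<rho> L) = (if M = K then 1 else 0)"
proof -
  \<comment> \<open>The difference of the two sides of the claim, so that linear independence of the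
    indicators yields the equality for all \<open>M\<close> at once.\<close>
  define c where "c M = (\<Sum>L | L \<in> \<L> \<and> L + K = M. \<rho> L) - (if M = K then 1 else 0)" for M
  have "(\<Sum>M\<in>\<L>. c M * indicator (annihilator M) \<xi>) = 0" for \<xi> :: "'a \<Rightarrow>\<^sub>L real"
  proof -
    have "(\<Sum>M\<in>\<L>. (\<Sum>L | L \<in> \<L> \<and> L + K = M. \<rho> L) * indicator (annihilator M) \<xi>)
        = (\<Sum>M\<in>\<L>. \<Sum>L | L \<in> \<L> \<and> L + K = M. \<rho> L * indicator (annihilator (L + K)) \<xi>)"
      by (simp add: sum_distrib_right)
    \<comment> \<open>Stability under sum puts \<open>L + K\<close> back in \<L>, so each
      \<open>L\<close> is counted in exactly one fiber.\<close>
    also have "\<dots> = (\<Sum>L\<in>\<L>. \<rho> L * indicator (annihilator (L + K)) \<xi>)"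
      using \<L> K by (intro sum.group) auto
    also have "\<dots> = (\<Sum>L\<in>\<L>. \<rho> L * indicator (annihilator L) \<xi>) * indicator (annihilator K) \<xi>"
      unfolding sum_distrib_right using \<L>(2) K
      by (intro sum.cong) (simp_all add: annihilator_sum subspace_0 indicator_inter_arith mult.assoc)
    also have "\<dots> = indicator (\<Union>L\<in>\<L>. annihilator L) \<xi> * indicator (annihilator K) \<xi>"
      using \<rho> unfolding patchwork_function_def by metis
    \<comment> \<open>Since \<open>K\<close> belongs to \<L>, the union contains the annihilator of
      \<open>K\<close>.\<close>
    also have "\<dots> = indicator (annihilator K) \<xi>"
      using K by (auto simp: indicator_def)
    also have "\<dots> = (\<Sum>M\<in>\<L>. (if M = K then 1 else 0) * indicator (annihilator M) \<xi>)"
      using K \<L>(1) by (simp add: if_distrib[of "\<lambda>x. x * _"] cong: if_cong)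
    finally show ?thesis
      unfolding c_def by (simp add: left_diff_distrib sum_subtractf)
  qed
  then have "c M = 0"
    using indicator_annihilator_independent[OF F \<L>(1,2)] M by blast
  then show ?thesis
    unfolding c_def by simp
qed

theorem theorem17:
  fixes \<Lambda> :: "'a::real_normed_vector set"
    and Q :: "('a \<Rightarrow>\<^sub>L real) \<Rightarrow> ('a \<Rightarrow>\<^sub>L real) \<Rightarrow> real"
    and \<mu> :: "'a mu_family"
    and \<L> :: "'a set set"
    and \<rho> :: "'a set \<Rightarrow> int"
    and p f :: "'a set"
  assumes "rational_space \<Lambda>"
    and "rational_scalar_product \<Lambda> Q"
    and "is_mu_family \<Lambda> Q \<mu>"
    and "rational_polyhedron \<Lambda> p"
    and "f \<in> faces p"
    and "finite \<L>"
    and "\<And>L. L \<in> \<L> \<Longrightarrow> rational_subspace \<Lambda> L"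
    and "\<And>L M. L \<in> \<L> \<Longrightarrow> M \<in> \<L> \<Longrightarrow> L + M \<in> \<L>"
    and "patchwork_function \<L> \<rho>"
    and "lin f \<in> \<L>"
  shows "germ_eq (annihilator (lin f))
           (mu_patchwork \<mu> \<L> \<rho> p f) (\<mu> (lin f) (lin f) (transverse_cone p f))"
proof -
  define K where "K = lin f"
  define t where "t = transverse_cone p f"
  obtain F :: "'a set" where F: "finite F" "span F = UNIV"
    using \<open>rational_space \<Lambda>\<close> unfolding rational_space_def by blast
  have sub: "subspace L" if "L \<in> \<L>" for L
    using that assms(7) unfolding rational_subspace_def by blast
  have K: "K \<in> \<L>"
    using \<open>lin f \<in> \<L>\<close> unfolding K_def .
  \<comment> \<open>The identity is proved at every \<xi>, which is stronger than equality of
    germs.\<close>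
  have "mu_patchwork \<mu> \<L> \<rho> p f \<xi> = \<mu> K K t \<xi>" for \<xi>
  proof -
    have "mu_patchwork \<mu> \<L> \<rho> p f \<xi> = (\<Sum>L\<in>\<L>. of_int (\<rho> L) * \<mu> K (L + K) t \<xi>)"
      unfolding mu_patchwork_def K_def t_def ..
    also have "\<dots> = (\<Sum>M\<in>\<L>. \<Sum>L | L \<in> \<L> \<and> L + K = M. of_int (\<rho> L) * \<mu> K (L + K) t \<xi>)"
      using assms(6,8) K by (intro sum.group[symmetric]) auto
    \<comment> \<open>On a fiber the value of \<mu> depends only on \<open>M\<close>, so it factors
      out and leaves the sum of \<rho> over the fiber.\<close>
    also have "\<dots> = (\<Sum>M\<in>\<L>. of_int (\<Sum>L | L \<in> \<L> \<and> L + K = M. \<rho> L) * \<mu> K M t \<xi>)"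
      by (simp add: sum_distrib_right)
    also have "\<dots> = (\<Sum>M\<in>\<L>. of_int (if M = K then 1 else 0) * \<mu> K M t \<xi>)"
      using patchwork_sum_fiber[OF F \<open>finite \<L>\<close> sub assms(8,9) K] by (intro sum.cong) auto
    also have "\<dots> = (\<Sum>M\<in>\<L>. if M = K then \<mu> K K t \<xi> else 0)"
      by (intro sum.cong) auto
    also have "\<dots> = \<mu> K K t \<xi>"
      using K \<open>finite \<L>\<close> by simp
    finally show ?thesis .
  qed
  then show ?thesis
    unfolding germ_eq_def near0_def K_def t_def by simp
qed

end
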